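(* Let $V$ be a finite-dimensional (real or complex) normed vector space. Suppose that $D$ is a bounded strictly convex domain of $V$ and $(D,d)$ is a complete geodesic space whose topology coincides with the norm topology and which satisfies $$d(sx+(1-s)y,z)\leq \max\{d(x,z),d(y,z)\}\quad\text{for all }x,y,z\in D\text{ and }s\in[0,1].$$ If $f:D\rightarrow D$ is a nonexpansive mapping (with respect to $d$) without fixed points, then there exists $\xi\in\partial D$ such that the iterates $f^{n}$ of $f$ converge uniformly on bounded sets of $D$ to $\xi$.
   Context: $\overline{D}$ denotes the norm closure of $D$ in $V$ and $\partial D=\overline{D}\setminus D$. $D$ is strictly convex if for any distinct $z,w\in\overline{D}$ the open segment $(z,w)=\{sz+(1-s)w:s\in(0,1)\}$ lies in $D$. $(D,d)$ is a geodesic space if any two points are joined by a curve $\sigma:[a,b]\to D$ with $d(\sigma(t_1),\sigma(t_2))=|t_1-t_2|$ for all $t_1,t_2\in[a,b]$. $f$ is nonexpansive if $d(f(x),f(y))\le d(x,y)$ for all $x,y$. Uniform convergence on bounded sets to $\xi$ means: for each $d$-bounded $K\subset D$, $\sup_{y\in K}\|f^n(y)-\xi\|\to 0$. *)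

theory Defs
  imports "HOL-Analysis.Analysis"
begin

(* open_segment z w consists of the points s z + (1 - s) w with real s in (0,1); only the
   underlying real vector space structure is involved, also for complex spaces. *)
definition strictly_convex :: "'a::real_normed_vector set \<Rightarrow> bool" where
  "strictly_convex D \<longleftrightarrow>
     (\<forall>z\<in>closure D. \<forall>w\<in>closure D. z \<noteq> w \<longrightarrow> open_segment z w \<subseteq> D)"

definition geodesic_space :: "'a set \<Rightarrow> ('a \<Rightarrow> 'a \<Rightarrow> real) \<Rightarrow> bool" where
  "geodesic_space M d \<longleftrightarrow>
     (\<forall>x\<in>M. \<forall>y\<in>M. \<exists>(a::real) b \<sigma>. a \<le> b \<and> \<sigma> \<in> {a..b} \<rightarrow> M \<and> \<sigma> a = x \<and> \<sigma> b = y \<and>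
        (\<forall>t1\<in>{a..b}. \<forall>t2\<in>{a..b}. d (\<sigma> t1) (\<sigma> t2) = \<bar>t1 - t2\<bar>))"

definition nonexpansive_on :: "'a set \<Rightarrow> ('a \<Rightarrow> 'a \<Rightarrow> real) \<Rightarrow> ('a \<Rightarrow> 'a) \<Rightarrow> bool" where
  "nonexpansive_on M d f \<longleftrightarrow> (\<forall>x\<in>M. \<forall>y\<in>M. d (f x) (f y) \<le> d x y)"

end

theory Submission
  imports Defs
begin

text \<open>
Why the theorem holds. A complete locally compact geodesic space is proper (\<open>hopf_rinow\<close>): the closed
balls of \<open>d\<close> are compact, and therefore \<open>d\<close> tends to infinity at the boundary of \<open>D\<close>. If the orbit of a
point under \<open>f\<close> is \<open>d\<close>-bounded, Brouwer's theorem gives a fixed point, because the points from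
which the orbit eventually stays within a given distance form an invariant convex set with compact closure in \<open>D\<close>
(\<open>bounded_orbit_imp_fixed_point\<close>). So a fixed-point free \<open>f\<close> has unbounded orbits, and by Calka's theorem
(\<open>accumulating_orbit_mbounded\<close>) an unbounded orbit of a nonexpansive map has no limit point in \<open>D\<close> at all.

It remains to see that the orbit has a single limit point on the boundary. The geometric input is that
the midpoints of two sequences with different limits on the boundary stay in a compact part of \<open>D\<close>,
by strict convexity. With quasiconvexity of \<open>d\<close> this gives two facts. Sequences at bounded \<open>d\<close>-distance
share their boundary limit (\<open>boundary_limit_shared\<close>). And if \<open>x n\<close> and \<open>y n\<close> tend to boundary points
while \<open>d (x n) (y n)\<close> never exceeds \<open>d (x n) w\<close>, for a fixed \<open>w\<close>, then these boundary points agree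
(\<open>boundary_limits_eq\<close>). The second fact is applied, with \<open>w\<close> the starting point, to a subsequence of times
at which the orbit is at least as far away from \<open>w\<close> as at all earlier times, and to any other convergent subsequence
(\<open>unbounded_orbit_tendsto\<close>). The first fact turns convergence of one orbit into uniform convergence on
bounded sets (\<open>orbit_limit_uniform\<close>).
\<close>

section \<open>Compactness and Brouwer's theorem in finite-dimensional normed spaces\<close>

text \<open>Brouwer's theorem speaks about a type of class \<^class>\<open>euclidean_space\<close>, whose dimension is part of
the type. For a normed space of some finite dimension the right index type has to be made from the
space itself: a finite generating set, turned into the type \<open>'a generator\<close>. The vector \<open>0\<close> is added
so that the set is inhabited also in the trivial space, and for an infinite-dimensional \<open>'a\<close> the set is
just \<open>{0}\<close>, so that \<open>'a generator\<close> is finite whatever \<open>'a\<close> is.\<close>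

definition generating_set :: "'a::real_vector set" where
  "generating_set =
     insert 0 (if \<exists>B::'a set. finite B \<and> span B = UNIV
               then SOME B. finite B \<and> span B = UNIV else {})"

lemma finite_generating_set: "finite (generating_set :: 'a::real_vector set)"
  and span_generating_set:
    "\<exists>B::'a set. finite B \<and> span B = UNIV \<Longrightarrow> span (generating_set :: 'a set) = UNIV"
proof -
  have *: "finite (SOME B::'a set. finite B \<and> span B = UNIV) \<and>
      span (SOME B::'a set. finite B \<and> span B = UNIV) = UNIV"
    if "\<exists>B::'a set. finite B \<and> span B = UNIV"
    using someI_ex[OF that] .
  show "finite (generating_set :: 'a set)"
    using * by (simp add: generating_set_def)
  show "span (generating_set :: 'a set) = UNIV" if "\<exists>B::'a set. finite B \<and> span B = UNIV"
    using *[OF that] that by (simp add: generating_set_def span_insert_0)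
qed

typedef (overloaded) ('a::real_vector) generator = "generating_set :: 'a set"
  by (auto simp: generating_set_def)

instance generator :: (real_vector) finite
proof
  have "(UNIV :: ('a::real_vector) generator set) = Abs_generator ` generating_set"
    by (metis type_definition.Abs_image type_definition_generator)
  then show "finite (UNIV :: 'a generator set)"
    by (metis finite_generating_set finite_imageI)
qed

definition combination :: "real ^ 'a generator \<Rightarrow> 'a::real_normed_vector" where
  "combination c = (\<Sum>g\<in>UNIV. (c $ g) *\<^sub>R Rep_generator g)"

lemma bounded_linear_combination: "bounded_linear (combination :: _ \<Rightarrow> 'a::real_normed_vector)"
proof -
  have "linear (combination :: _ \<Rightarrow> 'a)"
    by (rule linearI)
      (simp_all add: combination_def scaleR_left_distrib sum.distrib scaleR_sum_right)
  then show ?thesis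
    by (simp add: linear_conv_bounded_linear)
qed

lemma surj_combination:
  assumes "\<exists>B::'a::real_normed_vector set. finite B \<and> span B = UNIV"
  shows "surj (combination :: real ^ 'a generator \<Rightarrow> 'a)"
proof -
  interpret bounded_linear "combination :: real ^ 'a generator \<Rightarrow> 'a"
    by (rule bounded_linear_combination)
  have "subspace (range (combination :: real ^ 'a generator \<Rightarrow> 'a))"
    by (intro linear_subspace_image linear_axioms subspace_UNIV)
  moreover have "generating_set \<subseteq> range (combination :: real ^ 'a generator \<Rightarrow> 'a)"
  proof
    fix b :: 'a assume "b \<in> generating_set"
    then obtain g where g: "b = Rep_generator g"
      by (metis Rep_generator_cases)
    have "combination (axis g 1) = (\<Sum>h\<in>UNIV. if h = g then b else 0)"
      unfolding combination_def by (rule sum.cong) (auto simp: axis_def g)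
    then have "combination (axis g 1) = b" by simp
    then show "b \<in> range combination" by (metis rangeI)
  qed
  ultimately have "span (generating_set :: 'a set) \<subseteq> range (combination :: real ^ 'a generator \<Rightarrow> 'a)"
    by (rule span_minimal[rotated])
  then show ?thesis
    using span_generating_set[OF assms] by auto
qed

text \<open>The linear coordinates are continuous although the norm of \<open>V\<close> is arbitrary: on the range of \<open>coords\<close>
the map \<^const>\<open>combination\<close> is injective, hence its norm is bounded below on the compact unit sphere
of that subspace, and the reciprocal of this bound is a Lipschitz constant of \<open>coords\<close>.\<close>

lemma finite_dim_linear_retract:
  assumes "\<exists>B::'a::real_normed_vector set. finite B \<and> span B = UNIV"
  shows "\<exists>coords :: 'a \<Rightarrow> real ^ 'a generator.
    bounded_linear coords \<and> (\<forall>v. combination (coords v) = v)"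
proof -
  interpret C: bounded_linear "combination :: real ^ 'a generator \<Rightarrow> 'a"
    by (rule bounded_linear_combination)
  obtain coords :: "'a \<Rightarrow> real ^ 'a generator"
    where lin: "linear coords" and inv: "combination \<circ> coords = id"
    using linear_surjective_right_inverse[OF C.linear_axioms surj_combination[OF assms]] by blast
  have inv': "combination (coords v) = v" for v
    using inv by (metis comp_apply id_apply)
  define S where "S = range coords"
  have "subspace S"
    unfolding S_def by (intro linear_subspace_image lin subspace_UNIV)
  have on_S: "coords (combination c) = c" if "c \<in> S" for c
    using that inv' by (auto simp: S_def)
  have "\<exists>e>0. \<forall>c\<in>S. e * norm c \<le> norm (combination c :: 'a)"
  proof (cases "S \<inter> sphere 0 1 = {}")
    case True
    have "c = 0" if "c \<in> S" for c
    proof (rule ccontr)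
      assume "c \<noteq> 0"
      then have "(1 / norm c) *\<^sub>R c \<in> S \<inter> sphere 0 1"
        using \<open>subspace S\<close> that by (simp add: subspace_scale)
      then show False using True by blast
    qed
    then have "1 * norm c \<le> norm (combination c :: 'a)" if "c \<in> S" for c
      using that by (metis eq_refl mult_1 norm_ge_zero norm_zero order_trans)
    then show ?thesis by (intro exI[of _ 1]) auto
  next
    case False
    have "compact (S \<inter> sphere 0 1)"
      by (intro closed_Int_compact closed_subspace \<open>subspace S\<close>) auto
    moreover have "continuous_on (S \<inter> sphere 0 1) (\<lambda>c. norm (combination c :: 'a))"
      by (intro continuous_on_norm C.continuous_on continuous_on_id)
    ultimately obtain m where m: "m \<in> S \<inter> sphere 0 1"
      and le: "\<And>c. c \<in> S \<inter> sphere 0 1 \<Longrightarrow> norm (combination m :: 'a) \<le> norm (combination c :: 'a)"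
      using continuous_attains_inf False by metis
    have "combination m \<noteq> (0 :: 'a)"
      using on_S[of m] m linear_0[OF lin] by auto
    moreover have "norm (combination m :: 'a) * norm c \<le> norm (combination c :: 'a)" if "c \<in> S" for c
    proof (cases "c = 0")
      case False
      then have "(1 / norm c) *\<^sub>R c \<in> S \<inter> sphere 0 1"
        using \<open>subspace S\<close> that by (simp add: subspace_scale)
      from le[OF this] show ?thesis
        using False by (simp add: C.scaleR field_simps)
    qed simp
    ultimately show ?thesis
      by (intro exI[of _ "norm (combination m :: 'a)"]) auto
  qed
  then obtain e where "e > 0" and e: "\<And>c. c \<in> S \<Longrightarrow> e * norm c \<le> norm (combination c :: 'a)"
    by blast
  have "norm (coords v) \<le> norm v * (1 / e)" for v
    using e[of "coords v"] inv'[of v] \<open>e > 0\<close> by (simp add: S_def field_simps)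
  then have "bounded_linear coords"
    using lin by (intro bounded_linear.intro bounded_linear_axioms.intro exI[of _ "1 / e"]) auto
  then show ?thesis using inv' by blast
qed

lemma finite_dim_compact:
  fixes K :: "'a::real_normed_vector set"
  assumes fd: "\<exists>B::'a set. finite B \<and> span B = UNIV"
    and "bounded K" "closed K"
  shows "compact K"
proof -
  obtain coords :: "'a \<Rightarrow> real ^ 'a generator"
    where coords: "bounded_linear coords" and inv: "\<And>v. combination (coords v) = v"
    using finite_dim_linear_retract[OF fd] by blast
  have "bounded (coords ` K)"
    by (rule bounded_linear_image[OF \<open>bounded K\<close> coords])
  then have "compact (closure (coords ` K))" by simp
  then have "compact (combination ` closure (coords ` K) :: 'a set)"
    by (intro compact_continuous_image linear_continuous_on bounded_linear_combination)
  then have "compact (K \<inter> combination ` closure (coords ` K))"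
    by (rule closed_Int_compact[OF \<open>closed K\<close>])
  moreover have "K \<subseteq> combination ` closure (coords ` K)"
  proof
    fix v assume "v \<in> K"
    then have "coords v \<in> closure (coords ` K)"
      by (intro subsetD[OF closure_subset] imageI)
    then show "v \<in> combination ` closure (coords ` K)"
      by (intro image_eqI[where x = "coords v"] inv[symmetric])
  qed
  ultimately show ?thesis
    by (simp only: Int_absorb2)
qed

text \<open>Conjugating \<open>f\<close> with the linear retraction gives a self-map of the compact convex set of coordinate
vectors of \<open>C\<close>, and \<^const>\<open>combination\<close> sends its fixed point to one of \<open>f\<close>.\<close>

lemma finite_dim_brouwer:
  fixes C :: "'a::real_normed_vector set"
  assumes fd: "\<exists>B::'a set. finite B \<and> span B = UNIV"
    and C: "compact C" "convex C" "C \<noteq> {}"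
    and f: "continuous_on C f" "f \<in> C \<rightarrow> C"
  obtains z where "z \<in> C" "f z = z"
proof -
  obtain coords :: "'a \<Rightarrow> real ^ 'a generator"
    where coords: "bounded_linear coords" and inv: "\<And>v. combination (coords v) = v"
    using finite_dim_linear_retract[OF fd] by blast
  have "continuous_on (coords ` C) (coords \<circ> f \<circ> combination)"
  proof (intro continuous_on_compose)
    show "continuous_on (coords ` C) (combination :: _ \<Rightarrow> 'a)"
      by (intro linear_continuous_on bounded_linear_combination)
    show "continuous_on (combination ` coords ` C) f"
      using f(1) inv by (simp add: image_image)
    show "continuous_on (f ` combination ` coords ` C) coords"
      by (intro linear_continuous_on coords)
  qed
  moreover have "compact (coords ` C)"
    by (intro compact_continuous_image linear_continuous_on coords C)
  moreover have "convex (coords ` C)"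
    by (intro convex_linear_image bounded_linear.linear coords C)
  moreover have "coords \<circ> f \<circ> combination \<in> coords ` C \<rightarrow> coords ` C"
    using f(2) inv by auto
  moreover have "coords ` C \<noteq> {}" using C(3) by blast
  ultimately obtain c where "c \<in> coords ` C" and "(coords \<circ> f \<circ> combination) c = c"
    using brouwer by metis
  then have "c \<in> coords ` C" and c: "coords (f (combination c)) = c"
    by simp_all
  then have "combination c \<in> C"
    using inv by auto
  moreover have "f (combination c) = combination c"
    using c inv by metis
  ultimately show ?thesis using that by blast
qed

section \<open>Proper geodesic spaces and orbits of nonexpansive maps\<close>

context Metric_space
begin

text \<open>The only use made of geodesics: one can move from \<open>y\<close> towards \<open>x\<close> by \<open>r\<close> and come closer to \<open>x\<close> by
the same amount, or reach \<open>x\<close> if it is nearer than \<open>r\<close>.\<close>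

lemma geodesic_division:
  assumes "geodesic_space M d" "x \<in> M" "y \<in> M" "0 \<le> r"
  obtains u where "u \<in> M" "d y u \<le> r" "d x u \<le> max 0 (d x y - r)"
proof -
  obtain a b :: real and \<sigma> where "a \<le> b" and \<sigma>: "\<sigma> \<in> {a..b} \<rightarrow> M" "\<sigma> a = x" "\<sigma> b = y"
    and iso: "\<And>s t. s \<in> {a..b} \<Longrightarrow> t \<in> {a..b} \<Longrightarrow> d (\<sigma> s) (\<sigma> t) = \<bar>s - t\<bar>"
    using assms unfolding geodesic_space_def by metis
  define t where "t = max a (b - r)"
  have t: "t \<in> {a..b}" using \<open>a \<le> b\<close> \<open>0 \<le> r\<close> by (auto simp: t_def)
  show ?thesis
  proof
    show "\<sigma> t \<in> M" using \<sigma>(1) t by blast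
    show "d y (\<sigma> t) \<le> r"
      using iso[of b t] t \<open>a \<le> b\<close> \<sigma>(3) by (auto simp: t_def)
    show "d x (\<sigma> t) \<le> max 0 (d x y - r)"
      using iso[of a t] iso[of a b] t \<open>a \<le> b\<close> \<sigma>(2,3) by (auto simp: t_def)
  qed
qed

text \<open>Every point of the ball of radius \<open>r\<close> is within \<open>s\<close> of the smaller ball of radius \<open>r - s\<close>, so finite
nets of the smaller balls are finite nets of the large one; a closed totally bounded subset of a
complete space is compact.\<close>

lemma compactin_mcball_limit:
  assumes geo: "geodesic_space M d" and "mcomplete" "w \<in> M"
    and smaller: "\<And>s. 0 \<le> s \<Longrightarrow> s < r \<Longrightarrow> compactin mtopology (mcball w s)"
    and "0 < r"
  shows "compactin mtopology (mcball w r)"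
proof -
  have "mtotally_bounded (mcball w r)"
    unfolding mtotally_bounded_def
  proof (intro allI impI)
    fix e :: real assume "e > 0"
    define s where "s = min (e/2) (r/2)"
    have s: "0 < s" "s \<le> e/2" "0 \<le> r - s" "r - s < r"
      using \<open>e > 0\<close> \<open>0 < r\<close> by (auto simp: s_def)
    then obtain F where F: "finite F" "F \<subseteq> mcball w (r - s)" "mcball w (r - s) \<subseteq> (\<Union>x\<in>F. mball x (e/2))"
      using compactin_imp_mtotally_bounded[OF smaller[of "r - s"]] \<open>e > 0\<close>
      unfolding mtotally_bounded_def by (meson half_gt_zero)
    have "mcball w r \<subseteq> (\<Union>x\<in>F. mball x e)"
    proof
      fix z assume z: "z \<in> mcball w r"
      then have "z \<in> M" by simp
      obtain u where u: "u \<in> M" "d z u \<le> s" "d w u \<le> max 0 (d w z - s)"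
        using geodesic_division[OF geo \<open>w \<in> M\<close> \<open>z \<in> M\<close>, of s] s by auto
      then have "u \<in> mcball w (r - s)"
        using z s \<open>w \<in> M\<close> by auto
      then obtain x where x: "x \<in> F" "x \<in> M" "d x u < e/2"
        using F(3) by auto
      then have "d x z < e"
        using triangle[OF \<open>x \<in> M\<close> \<open>u \<in> M\<close> \<open>z \<in> M\<close>] u(2) s(2) commute[of u z]
        by linarith
      then show "z \<in> (\<Union>x\<in>F. mball x e)"
        using x \<open>z \<in> M\<close> by auto
    qed
    moreover have "F \<subseteq> mcball w r"
      using F(2) s by force
    ultimately show "\<exists>K. finite K \<and> K \<subseteq> mcball w r \<and> mcball w r \<subseteq> (\<Union>x\<in>K. mball x e)"
      using F(1) by blast
  qed
  then have "compactin mtopology (mtopology closure_of mcball w r)"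
    using mtotally_bounded_eq_compact_closure_of[OF \<open>mcomplete\<close>] by blast
  then show ?thesis by (simp add: closure_of_closedin)
qed

text \<open>A compact set has a compact neighbourhood, and a Lebesgue number shows that this neighbourhood
contains all points at a small enough distance from the ball; along geodesics these make up a larger
ball.\<close>

lemma compactin_mcball_enlarge:
  assumes geo: "geodesic_space M d" and lc: "locally_compact_space mtopology"
    and "w \<in> M" "0 \<le> r" and cpt: "compactin mtopology (mcball w r)"
  obtains s where "r < s" "compactin mtopology (mcball w s)"
proof -
  obtain U K where U: "openin mtopology U" and K: "compactin mtopology K"
    and sub: "mcball w r \<subseteq> U" "U \<subseteq> K"
    using locally_compact_space_compact_closed_compact[of mtopology] lc cpt Hausdorff_space_mtopology
    by metis
  obtain e where "e > 0" and e: "\<And>x. x \<in> mcball w r \<Longrightarrow> mball x e \<subseteq> U"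
    using lebesgue_number[OF cpt, of "{U}"] sub(1) U by auto
  have "mcball w (r + e/2) \<subseteq> K"
  proof
    fix z assume z: "z \<in> mcball w (r + e/2)"
    then have "z \<in> M" by simp
    obtain u where u: "u \<in> M" "d z u \<le> e/2" "d w u \<le> max 0 (d w z - e/2)"
      using geodesic_division[OF geo \<open>w \<in> M\<close> \<open>z \<in> M\<close>, of "e/2"] \<open>e > 0\<close> by auto
    then have "u \<in> mcball w r"
      using z \<open>w \<in> M\<close> \<open>0 \<le> r\<close> by auto
    moreover have "z \<in> mball u e"
      using u \<open>z \<in> M\<close> \<open>e > 0\<close> commute[of u z] by auto
    ultimately show "z \<in> K" using e sub(2) by blast
  qed
  then have "compactin mtopology (mcball w (r + e/2))"
    using closed_compactin K closedin_mcball by metis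
  then show ?thesis
    using that[of "r + e/2"] \<open>e > 0\<close> by simp
qed

text \<open>By the two previous lemmas the radii of compact balls around \<open>w\<close> form a set which is closed under
suprema and has no greatest element, so it is unbounded.\<close>

theorem hopf_rinow:
  assumes geo: "geodesic_space M d" and "mcomplete" and lc: "locally_compact_space mtopology"
  shows "compactin mtopology (mcball w r)"
proof (cases "w \<in> M \<and> 0 \<le> r")
  case False
  then have "mcball w r = {}" by (auto simp: mcball_eq_empty)
  then show ?thesis by simp
next
  case True
  then have "w \<in> M" by blast
  define S where "S = {s. 0 \<le> s \<and> compactin mtopology (mcball w s)}"
  have down: "compactin mtopology (mcball w s)" if "t \<in> S" "s \<le> t" for s t
    using that closed_compactin[of mtopology "mcball w t" "mcball w s"] mcball_subset_concentric[of s t w]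
    by (auto simp: S_def)
  have "mcball w 0 = {w}"
  proof -
    have "y = w" if "y \<in> M" "d w y \<le> 0" for y
      using mdist_pos_less[of w y] that \<open>w \<in> M\<close> by fastforce
    then show ?thesis using \<open>w \<in> M\<close> by auto
  qed
  then have "0 \<in> S" using \<open>w \<in> M\<close> by (simp add: S_def)
  show ?thesis
  proof (rule ccontr)
    assume not: "\<not> ?thesis"
    then have le: "s \<le> r" if "s \<in> S" for s
      using down[OF that, of r] by force
    then have bdd: "bdd_above S" by (rule bdd_aboveI)
    define R where "R = Sup S"
    have "0 \<le> R" unfolding R_def by (rule cSup_upper[OF \<open>0 \<in> S\<close> bdd])
    have "compactin mtopology (mcball w s)" if less: "s < R" for s
    proof -
      obtain t where "t \<in> S" "s < t"
        using less_cSupD[of S s] less \<open>0 \<in> S\<close> unfolding R_def by blast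
      then show ?thesis using down by simp
    qed
    then have "compactin mtopology (mcball w R)"
      using compactin_mcball_limit[OF geo \<open>mcomplete\<close> \<open>w \<in> M\<close>, of R] \<open>0 \<le> R\<close> \<open>0 \<in> S\<close>
      by (cases "R = 0") (auto simp: S_def)
    then obtain s where "R < s" "compactin mtopology (mcball w s)"
      using compactin_mcball_enlarge[OF geo lc \<open>w \<in> M\<close> \<open>0 \<le> R\<close>] by blast
    then have "s \<in> S" using \<open>0 \<le> R\<close> by (simp add: S_def)
    then show False using cSup_upper[OF _ bdd] \<open>R < s\<close> by (force simp: R_def)
  qed
qed

lemma funpow_mem:
  assumes "f \<in> M \<rightarrow> M" "x \<in> M"
  shows "(f ^^ n) x \<in> M"
  using assms by (induction n) auto

lemma nonexpansive_funpow:
  assumes "nonexpansive_on M d f" "f \<in> M \<rightarrow> M" "x \<in> M" "y \<in> M"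
  shows "d ((f ^^ n) x) ((f ^^ n) y) \<le> d x y"
proof (induction n)
  case (Suc n)
  have "d (f ((f ^^ n) x)) (f ((f ^^ n) y)) \<le> d ((f ^^ n) x) ((f ^^ n) y)"
    using assms funpow_mem[OF assms(2)] unfolding nonexpansive_on_def by blast
  then show ?case using Suc by simp
qed simp

lemma nonexpansive_orbit_shift:
  assumes "nonexpansive_on M d f" "f \<in> M \<rightarrow> M" "x \<in> M" "m \<le> n"
  shows "d ((f ^^ n) x) ((f ^^ m) x) \<le> d ((f ^^ (n - m)) x) x"
proof -
  have "(f ^^ n) x = (f ^^ m) ((f ^^ (n - m)) x)"
    using \<open>m \<le> n\<close> by (metis comp_apply funpow_add le_add_diff_inverse)
  then show ?thesis
    using nonexpansive_funpow[OF assms(1,2) funpow_mem[OF assms(2,3)] assms(3)] by metis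
qed

text \<open>Between two visits to the unit ball around \<open>\<eta>\<close> the orbit has at most \<open>b\<close> steps to go away, and \<open>k\<close>
steps starting anywhere on the orbit move a point no farther than the first \<open>k\<close> steps move \<open>x\<close>.\<close>

lemma visits_imp_orbit_mbounded:
  assumes f: "nonexpansive_on M d f" "f \<in> M \<rightarrow> M" and "x \<in> M" "\<eta> \<in> M"
    and visits: "\<And>n. n0 \<le> n \<Longrightarrow> \<exists>m\<le>n. n \<le> m + b \<and> d ((f ^^ m) x) \<eta> \<le> 1"
  shows "mbounded (range (\<lambda>n. (f ^^ n) x))"
proof -
  let ?o = "\<lambda>n. (f ^^ n) x"
  have o: "?o n \<in> M" for n by (rule funpow_mem[OF f(2) \<open>x \<in> M\<close>])
  define c where "c = Max ((\<lambda>k. d (?o k) x) ` {..b})"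
  have c: "d (?o k) x \<le> c" if "k \<le> b" for k
    unfolding c_def using that by (intro Max_ge) auto
  have "?o n \<in> mcball \<eta> (c + 1)" if n: "n0 \<le> n" for n
  proof -
    obtain m where m: "m \<le> n" "n \<le> m + b" "d (?o m) \<eta> \<le> 1"
      using visits[OF n] by blast
    have "d (?o n) (?o m) \<le> c"
      using nonexpansive_orbit_shift[OF f \<open>x \<in> M\<close> m(1)] c[of "n - m"] m(2) by fastforce
    then have "d (?o n) \<eta> \<le> c + 1"
      using triangle[OF o o \<open>\<eta> \<in> M\<close>, of n m] m(3) by linarith
    then show ?thesis using o \<open>\<eta> \<in> M\<close> commute by simp
  qed
  then have "mbounded (?o ` {n0..})"
    by (intro mbounded_subset[OF mbounded_mcball[of \<eta> "c + 1"]]) auto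
  moreover have "mbounded (?o ` {..<n0})"
    by (intro mtotally_bounded_imp_mbounded finite_imp_mtotally_bounded) (use o in auto)
  moreover have "range ?o = ?o ` {..<n0} \<union> ?o ` {n0..}"
    by (force simp: not_less)
  ultimately show ?thesis by (simp add: mbounded_Un)
qed

text \<open>This is Calka's theorem. Every orbit point in the unit ball around \<open>\<eta>\<close> returns to that ball, because
the orbit comes arbitrarily close to \<open>\<eta>\<close> again. The point is that the return times are bounded: in a
proper space the orbit points in the ball have a finite \<open>1/2\<close>-net \<open>F\<close> of orbit points, and as \<open>f\<close> is
nonexpansive, an orbit point within \<open>1/2\<close> of \<open>p \<in> F\<close> can use the time at which \<open>p\<close> comes within \<open>1/2\<close>
of \<open>\<eta>\<close>. So the visits have bounded gaps.\<close>

theorem accumulating_orbit_mbounded: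
  assumes proper: "\<And>w r. compactin mtopology (mcball w r)"
    and f: "nonexpansive_on M d f" "f \<in> M \<rightarrow> M" and "x \<in> M"
    and k: "strict_mono k" and lim: "limitin mtopology (\<lambda>j. (f ^^ k j) x) \<eta> sequentially"
  shows "mbounded (range (\<lambda>n. (f ^^ n) x))"
proof -
  let ?o = "\<lambda>n. (f ^^ n) x"
  have o: "?o n \<in> M" for n by (rule funpow_mem[OF f(2) \<open>x \<in> M\<close>])
  have "\<eta> \<in> M" using lim limitin_mspace by blast
  have late: "\<exists>n>m. d (?o n) \<eta> < 1/2" for m
  proof -
    obtain N where N: "\<And>j. j \<ge> N \<Longrightarrow> d (?o (k j)) \<eta> < 1/2"
      using lim unfolding limit_metric_sequentially by (meson half_gt_zero zero_less_one)
    have "k (max N (Suc m)) > m"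
      using seq_suble[OF k, of "max N (Suc m)"] by simp
    then show ?thesis using N[of "max N (Suc m)"] by auto
  qed
  define S where "S = range ?o \<inter> mcball \<eta> 1"
  have "mtotally_bounded S"
    using compactin_imp_mtotally_bounded[OF proper] mtotally_bounded_subset by (metis S_def inf_le2)
  then obtain F where "finite F" "F \<subseteq> S" and F: "S \<subseteq> (\<Union>p\<in>F. mball p (1/2))"
    unfolding mtotally_bounded_def by (meson half_gt_zero zero_less_one)
  have "\<exists>m>0. d ((f ^^ m) p) \<eta> < 1/2" if p: "p \<in> F" for p
  proof -
    obtain i where i: "p = ?o i" using p \<open>F \<subseteq> S\<close> by (auto simp: S_def)
    obtain n where n: "n > i" "d (?o n) \<eta> < 1/2" using late by blast
    have "?o n = (f ^^ (n - i)) p"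
      using n(1) by (metis i comp_apply funpow_add le_add_diff_inverse2 less_imp_le)
    then show ?thesis using n by (intro exI[of _ "n - i"]) auto
  qed
  then obtain m where m: "\<And>p. p \<in> F \<Longrightarrow> m p > 0" "\<And>p. p \<in> F \<Longrightarrow> d ((f ^^ m p) p) \<eta> < 1/2"
    by metis
  define b where "b = Max (insert 0 (m ` F))"
  have b: "m p \<le> b" if "p \<in> F" for p
    unfolding b_def using \<open>finite F\<close> that by (intro Max_ge) auto
  obtain n0 where n0: "d (?o n0) \<eta> < 1/2" using late by blast
  have "\<exists>i\<le>n. n \<le> i + b \<and> d (?o i) \<eta> \<le> 1" if "n0 \<le> n" for n
    using that
  proof (induction n rule: dec_induct)
    case base
    show ?case using n0 by (intro exI[of _ n0]) auto
  next
    case (step n)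
    then obtain i where i: "i \<le> n" "n \<le> i + b" "d (?o i) \<eta> \<le> 1" by blast
    show ?case
    proof (cases "Suc n \<le> i + b")
      case True
      then show ?thesis using i by (intro exI[of _ i]) auto
    next
      case False
      \<comment> \<open>Here \<open>n = i + b\<close>; the next visit comes \<open>1\<close> to \<open>b\<close> steps after \<open>i\<close>, and so it serves for \<open>Suc n\<close>.\<close>
      have "?o i \<in> S" using i(3) o \<open>\<eta> \<in> M\<close> commute by (auto simp: S_def)
      then obtain p where p: "p \<in> F" "p \<in> M" "d p (?o i) < 1/2" using F by auto
      have "d ((f ^^ m p) p) ((f ^^ m p) (?o i)) < 1/2"
        using nonexpansive_funpow[OF f p(2) o, of "m p" i] p(3) by linarith
      then have "d (?o (m p + i)) \<eta> \<le> 1"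
        using triangle''[OF o[of "m p + i"] funpow_mem[OF f(2) p(2)] \<open>\<eta> \<in> M\<close>, of "m p"] m(2)[OF p(1)]
        by (simp add: funpow_add)
      then show ?thesis
        using m(1)[OF p(1)] b[OF p(1)] i False by (intro exI[of _ "m p + i"]) auto
    qed
  qed
  then show ?thesis
    by (rule visits_imp_orbit_mbounded[OF f \<open>x \<in> M\<close> \<open>\<eta> \<in> M\<close>])
qed

end

section \<open>Subsequences and strictly convex sets\<close>

lemma subseq_of_frequently:
  assumes "\<exists>\<^sub>F n in sequentially. P (n :: nat)"
  obtains r :: "nat \<Rightarrow> nat" where "strict_mono r" "\<And>n. P (r n)"
proof -
  have "infinite {n. P n}"
    using assms by (simp add: frequently_cofinite flip: cofinite_eq_sequentially)
  then show ?thesis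
    using infinite_enumerate[of "{n. P n}"] that by auto
qed

lemma compact_not_tendsto_subseq:
  fixes s :: "nat \<Rightarrow> 'a::metric_space"
  assumes "compact K" "\<And>n. s n \<in> K" "\<not> s \<longlonglongrightarrow> l"
  obtains r l' where "strict_mono r" "l' \<in> K" "l' \<noteq> l" "(\<lambda>n. s (r n)) \<longlonglongrightarrow> l'"
proof -
  obtain e where "e > 0" and e: "\<exists>\<^sub>F n in sequentially. e \<le> dist (s n) l"
    using assms(3) by (auto simp: tendsto_iff not_eventually not_less)
  obtain q :: "nat \<Rightarrow> nat" where q: "strict_mono q" "\<And>n. e \<le> dist (s (q n)) l"
    using subseq_of_frequently[OF e] by blast
  obtain l' p where "l' \<in> K" and p: "strict_mono p" "((\<lambda>n. s (q n)) \<circ> p) \<longlonglongrightarrow> l'"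
    using \<open>compact K\<close> assms(2) unfolding compact_def by metis
  then have lim: "(\<lambda>n. s ((q \<circ> p) n)) \<longlonglongrightarrow> l'" by (simp add: comp_def)
  then have "(\<lambda>n. dist (s ((q \<circ> p) n)) l) \<longlonglongrightarrow> dist l' l"
    by (intro tendsto_dist tendsto_const)
  then have "e \<le> dist l' l"
    by (rule tendsto_lowerbound) (use q(2) in auto)
  then show ?thesis
    using that[OF strict_mono_o[OF q(1) p(1)] \<open>l' \<in> K\<close> _ lim] \<open>e > 0\<close> by force
qed

lemma strictly_convex_imp_convex:
  assumes "strictly_convex D"
  shows "convex D"
proof -
  have "closed_segment x y \<subseteq> D" if xy: "x \<in> D" "y \<in> D" for x y
  proof (cases "x = y")
    case True then show ?thesis using xy by simp
  next
    case False
    then have "open_segment x y \<subseteq> D"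
      using assms xy closure_subset[of D] unfolding strictly_convex_def by blast
    then show ?thesis using xy by (auto simp: open_segment_def)
  qed
  then show ?thesis by (simp add: convex_contains_segment)
qed

section \<open>Quasiconvex metrics on strictly convex domains\<close>

locale quasiconvex_domain = Metric_space D d
  for D :: "'a::real_normed_vector set" and d +
  assumes finite_dim: "\<exists>B::'a set. finite B \<and> span B = UNIV"
    and open_D: "open D" and bounded_D: "bounded D"
    and strictly_convex_D: "strictly_convex D"
    and mcomplete: mcomplete
    and geodesic: "geodesic_space D d"
    and top_eq: "mtopology = top_of_set D"
    and quasiconvex: "\<And>x y z s. \<lbrakk>x \<in> D; y \<in> D; z \<in> D; 0 \<le> s; s \<le> 1\<rbrakk> \<Longrightarrow>
          d (s *\<^sub>R x + (1 - s) *\<^sub>R y) z \<le> max (d x z) (d y z)"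
begin

lemma locally_compact_mtopology: "locally_compact_space mtopology"
proof -
  have "\<exists>U K. openin (top_of_set D) U \<and> compactin (top_of_set D) K \<and> x \<in> U \<and> U \<subseteq> K"
    if "x \<in> D" for x
  proof -
    obtain e where "e > 0" and e: "cball x e \<subseteq> D"
      using open_D \<open>x \<in> D\<close> open_contains_cball by blast
    have "compact (cball x e)"
      by (intro finite_dim_compact finite_dim) auto
    moreover have "openin (top_of_set D) (ball x e)"
      using e ball_subset_cball by (intro open_openin_trans open_D open_ball) auto
    ultimately show ?thesis
      using e \<open>e > 0\<close> by (intro exI[of _ "ball x e"] exI[of _ "cball x e"])
        (auto simp: compactin_subtopology)
  qed
  then show ?thesis
    by (simp add: locally_compact_space_def top_eq)
qed

lemma compactin_mcball: "compactin mtopology (mcball w r)"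
  by (rule hopf_rinow[OF geodesic mcomplete locally_compact_mtopology])

lemma compact_mcball: "compact (mcball w r)"
  using compactin_mcball[of w r] by (simp add: top_eq compactin_subtopology)

lemma limitin_mtopology_iff:
  assumes "\<And>n. s n \<in> D"
  shows "limitin mtopology s l sequentially \<longleftrightarrow> l \<in> D \<and> s \<longlonglongrightarrow> l"
  using assms by (simp add: top_eq limitin_subtopology)

lemma tendsto_imp_d_tendsto_0:
  assumes "\<And>n. s n \<in> D" "l \<in> D" "s \<longlonglongrightarrow> l"
  shows "(\<lambda>n. d (s n) l) \<longlonglongrightarrow> 0"
proof -
  have "limitin mtopology s l sequentially"
    using limitin_mtopology_iff[OF assms(1)] assms(2,3) by simp
  then show ?thesis by (simp add: limitin_metric_dist_null)
qed

text \<open>Norm limits of \<open>d\<close>-bounded sequences stay in \<open>D\<close>, as the balls of \<open>d\<close> are compact. In other words, a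
sequence in \<open>D\<close> that converges to a boundary point leaves every \<open>d\<close>-bounded set.\<close>

lemma bounded_limit_in_domain:
  assumes "\<And>n. s n \<in> D" "w \<in> D" "s \<longlonglongrightarrow> l" "eventually (\<lambda>n. d (s n) w \<le> c) sequentially"
  shows "l \<in> D"
proof -
  have "eventually (\<lambda>n. s n \<in> mcball w c) sequentially"
    using assms(4) by eventually_elim (use assms(1,2) commute in auto)
  then have "l \<in> mcball w c"
    using Lim_in_closed_set[OF compact_imp_closed[OF compact_mcball]] assms(3)
      trivial_limit_sequentially by blast
  then show ?thesis by simp
qed

lemma compact_closure_D: "compact (closure D)"
  by (rule finite_dim_compact[OF finite_dim bounded_closure[OF bounded_D] closed_closure])

text \<open>The points which are eventually within \<open>c\<close> of the orbit form an \<open>f\<close>-invariant set \<open>A\<close>; it is convex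
because the balls of \<open>d\<close> are, and bounded. Its norm closure lies in a compact ball of \<open>d\<close>, hence in \<open>D\<close>,
and Brouwer's theorem applies to it.\<close>

lemma bounded_orbit_imp_fixed_point:
  assumes f: "nonexpansive_on D d f" "f \<in> D \<rightarrow> D" and "x \<in> D"
    and bdd: "mbounded (range (\<lambda>n. (f ^^ n) x))"
  shows "\<exists>z\<in>D. f z = z"
proof -
  let ?o = "\<lambda>n. (f ^^ n) x"
  have o: "?o n \<in> D" for n by (rule funpow_mem[OF f(2) \<open>x \<in> D\<close>])
  obtain a c where "range ?o \<subseteq> mcball a c"
    using bdd unfolding mbounded_def by blast
  then have in_ball: "?o n \<in> mcball a c" for n by blast
  have "a \<in> D" using in_ball[of 0] by simp
  have c: "d (?o n) a \<le> c" for n using in_ball[of n] commute[of a] by simp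
  define A where "A = {y \<in> D. \<exists>N. \<forall>n\<ge>N. d (?o n) y \<le> c}"
  have "a \<in> A" using \<open>a \<in> D\<close> c by (auto simp: A_def)
  have "A \<subseteq> mcball a (2 * c)"
  proof
    fix y assume "y \<in> A"
    then obtain N where "y \<in> D" "d (?o N) y \<le> c" by (auto simp: A_def)
    then show "y \<in> mcball a (2 * c)"
      using triangle''[OF \<open>a \<in> D\<close> o \<open>y \<in> D\<close>, of N] c[of N] commute \<open>a \<in> D\<close>
        triangle[OF \<open>a \<in> D\<close> o \<open>y \<in> D\<close>, of N] by auto
  qed
  then have sub: "closure A \<subseteq> mcball a (2 * c)"
    by (intro closure_minimal compact_imp_closed compact_mcball)
  then have "closure A \<subseteq> D" using mcball_subset_mspace by blast
  have "convex A"
    unfolding convex_alt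
  proof (intro ballI allI impI)
    fix y z and u :: real assume yz: "y \<in> A" "z \<in> A" and u: "0 \<le> u \<and> u \<le> 1"
    from yz obtain N1 N2 where N: "\<And>n. N1 \<le> n \<Longrightarrow> d (?o n) y \<le> c" "\<And>n. N2 \<le> n \<Longrightarrow> d (?o n) z \<le> c"
      and "y \<in> D" "z \<in> D" by (auto simp: A_def)
    have "d (?o n) ((1 - u) *\<^sub>R y + u *\<^sub>R z) \<le> c" if "max N1 N2 \<le> n" for n
      using quasiconvex[OF \<open>y \<in> D\<close> \<open>z \<in> D\<close> o, of "1 - u" n] N[of n] that u
      by (simp add: commute[of "?o n"] max_def split: if_splits)
    moreover have "(1 - u) *\<^sub>R y + u *\<^sub>R z \<in> D"
      using u by (intro convexD strictly_convex_imp_convex strictly_convex_D \<open>y \<in> D\<close> \<open>z \<in> D\<close>) auto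
    ultimately show "(1 - u) *\<^sub>R y + u *\<^sub>R z \<in> A"
      unfolding A_def by blast
  qed
  have "f y \<in> A" if y: "y \<in> A" for y
  proof -
    obtain N where "y \<in> D" and N: "\<And>n. N \<le> n \<Longrightarrow> d (?o n) y \<le> c"
      using y by (auto simp: A_def)
    have "d (?o n) (f y) \<le> c" if n: "Suc N \<le> n" for n
    proof -
      obtain m where "n = Suc m" "N \<le> m" using n by (cases n) auto
      have "d (f (?o m)) (f y) \<le> d (?o m) y"
        using f(1) o \<open>y \<in> D\<close> unfolding nonexpansive_on_def by blast
      then show ?thesis using N[OF \<open>N \<le> m\<close>] \<open>n = Suc m\<close> by simp
    qed
    then show ?thesis using f(2) \<open>y \<in> D\<close> by (auto simp: A_def)
  qed
  then have "f ` A \<subseteq> closure A" using closure_subset[of A] by blast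
  have "continuous_map mtopology mtopology f"
    unfolding continuous_map_to_metric
  proof (intro ballI allI impI)
    fix y and e :: real assume "y \<in> topspace mtopology" "0 < e"
    have "f z \<in> mball (f y) e" if z: "z \<in> mball y e" for z
    proof -
      have "d (f y) (f z) \<le> d y z"
        using f(1) z by (simp add: nonexpansive_on_def)
      then show ?thesis using f(2) z by auto
    qed
    then show "\<exists>U. openin mtopology U \<and> y \<in> U \<and> (\<forall>z\<in>U. f z \<in> mball (f y) e)"
      using \<open>y \<in> topspace mtopology\<close> \<open>0 < e\<close> by (intro exI[of _ "mball y e"] conjI ballI) auto
  qed
  then have cont: "continuous_on (closure A) f"
    using \<open>closure A \<subseteq> D\<close> by (auto simp: top_eq intro: continuous_on_subset)
  then have "f \<in> closure A \<rightarrow> closure A"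
    using image_closure_subset[OF cont closed_closure \<open>f ` A \<subseteq> closure A\<close>] by blast
  moreover have "compact (closure A)"
    by (rule compact_Int_closed[OF compact_mcball[of a "2 * c"] closed_closure, of A, unfolded inf.absorb2[OF sub]])
  moreover have "convex (closure A)" by (rule convex_closure[OF \<open>convex A\<close>])
  moreover have "closure A \<noteq> {}" using \<open>a \<in> A\<close> closure_subset by blast
  ultimately obtain z where "z \<in> closure A" "f z = z"
    using finite_dim_brouwer[OF finite_dim] cont by metis
  then show ?thesis using \<open>closure A \<subseteq> D\<close> by blast
qed

section \<open>Sequences converging to the boundary\<close>

lemma midpoint_in_domain:
  assumes "\<xi> \<in> closure D" "\<eta> \<in> closure D" "\<xi> \<noteq> \<eta>"
  shows "midpoint \<xi> \<eta> \<in> D"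
proof -
  have "open_segment \<xi> \<eta> \<subseteq> D"
    using assms strictly_convex_D unfolding strictly_convex_def by blast
  then show ?thesis
    by (rule subsetD) (simp add: \<open>\<xi> \<noteq> \<eta>\<close>)
qed

text \<open>Strict convexity enters here. The midpoints of \<open>x n\<close> and \<open>y n\<close> converge to an interior point, hence
stay at bounded \<open>d\<close>-distance from \<open>w\<close>, and by quasiconvexity the midpoint is no farther from \<open>x n\<close>
than \<open>y n\<close> is. The additive constant depends on the two limits but not on the sequences, which
\<open>boundary_limits_eq\<close> relies on.\<close>

lemma separated_limits:
  assumes xy: "\<And>n. x n \<in> D" "\<And>n. y n \<in> D" and lim: "x \<longlonglongrightarrow> \<xi>" "y \<longlonglongrightarrow> \<eta>"
    and "\<xi> \<noteq> \<eta>" "w \<in> D"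
  shows "eventually (\<lambda>n. d (x n) w \<le> d (x n) (y n) + (1 + d (midpoint \<xi> \<eta>) w)) sequentially"
proof -
  have "\<xi> \<in> closure D" "\<eta> \<in> closure D"
    using xy lim closure_sequential by blast+
  then have p: "midpoint \<xi> \<eta> \<in> D"
    using midpoint_in_domain \<open>\<xi> \<noteq> \<eta>\<close> by blast
  define z where "z n = midpoint (x n) (y n)" for n
  have z: "z n \<in> D" for n
    using convex_contains_segment[of D] strictly_convex_imp_convex[OF strictly_convex_D] xy
    unfolding z_def by (metis midpoint_in_closed_segment subsetD)
  have zx: "d (z n) (x n) \<le> d (x n) (y n)" for n
    using quasiconvex[of "x n" "y n" "x n" "1/2"] xy commute[of "x n" "y n"]
    by (simp add: z_def midpoint_def scaleR_add_right)
  have "z \<longlonglongrightarrow> midpoint \<xi> \<eta>"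
    unfolding z_def midpoint_def by (intro tendsto_intros lim)
  then have "(\<lambda>n. d (z n) (midpoint \<xi> \<eta>)) \<longlonglongrightarrow> 0"
    by (rule tendsto_imp_d_tendsto_0[OF z p])
  then have "eventually (\<lambda>n. d (z n) (midpoint \<xi> \<eta>) < 1) sequentially"
    by (rule order_tendstoD) simp
  then show ?thesis
  proof eventually_elim
    case (elim n)
    have "d (x n) w \<le> d (z n) (x n) + d (z n) w"
      using triangle''[OF xy(1) \<open>w \<in> D\<close> z, of n n] triangle[OF xy(1) z \<open>w \<in> D\<close>, of n n] commute by metis
    moreover have "d (z n) w \<le> d (z n) (midpoint \<xi> \<eta>) + d (midpoint \<xi> \<eta>) w"
      by (rule triangle[OF z p \<open>w \<in> D\<close>])
    ultimately show ?case using elim zx[of n] by linarith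
  qed
qed

text \<open>If \<open>u\<close> had another limit point, \<open>separated_limits\<close> would bound the distances of \<open>y n\<close> from a fixed point
along a subsequence, whereas \<open>y\<close> leaves every bounded set.\<close>

lemma boundary_limit_shared:
  assumes yu: "\<And>n. y n \<in> D" "\<And>n. u n \<in> D" and lim: "y \<longlonglongrightarrow> \<eta>" and "\<eta> \<notin> D"
    and near: "\<And>n. d (y n) (u n) \<le> c"
  shows "u \<longlonglongrightarrow> \<eta>"
proof (rule ccontr)
  assume not: "\<not> u \<longlonglongrightarrow> \<eta>"
  have cl: "u n \<in> closure D" for n
    by (rule subsetD[OF closure_subset yu(2)])
  obtain r \<eta>' where r: "strict_mono r" and "\<eta>' \<noteq> \<eta>" and lim': "(\<lambda>n. u (r n)) \<longlonglongrightarrow> \<eta>'"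
    by (rule compact_not_tendsto_subseq[OF compact_closure_D cl not])
  have limr: "(\<lambda>n. y (r n)) \<longlonglongrightarrow> \<eta>"
    using LIMSEQ_subseq_LIMSEQ[OF lim r] by (simp add: comp_def)
  let ?w = "y 0"
  have "eventually (\<lambda>n. d (y (r n)) ?w \<le> d (y (r n)) (u (r n)) + (1 + d (midpoint \<eta> \<eta>') ?w)) sequentially"
    using yu lim' limr \<open>\<eta>' \<noteq> \<eta>\<close> by (intro separated_limits) auto
  then have "eventually (\<lambda>n. d (y (r n)) ?w \<le> c + (1 + d (midpoint \<eta> \<eta>') ?w)) sequentially"
    by eventually_elim (meson near add_right_mono order_trans)
  then have "\<eta> \<in> D"
    using bounded_limit_in_domain[of "\<lambda>n. y (r n)"] yu(1) limr by blast
  then show False using \<open>\<eta> \<notin> D\<close> by blast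
qed

text \<open>In a hyperbolic plane, sequences with different boundary limits are much farther from each other than
from a base point; this is the form of that property needed here. It is obtained by letting \<open>u n\<close> be
the point at distance \<open>c + 1\<close> from \<open>y n\<close> on a geodesic to \<open>x n\<close> (or \<open>x n\<close> itself if it is nearer). It has the same limit as \<open>y n\<close>, so
\<open>separated_limits\<close> holds for \<open>u\<close> with the constant \<open>c\<close> that it has for \<open>y\<close>, which is smaller than
the gain \<open>c + 1\<close> in distance. If the limits were different, \<open>d (x n) w\<close> would therefore stay bounded.\<close>

lemma boundary_limits_eq:
  assumes xy: "\<And>n. x n \<in> D" "\<And>n. y n \<in> D" and lim: "x \<longlonglongrightarrow> \<xi>" "y \<longlonglongrightarrow> \<eta>"
    and "\<xi> \<notin> D" "\<eta> \<notin> D" "w \<in> D"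
    and le: "\<And>n. d (x n) (y n) \<le> d (x n) w"
  shows "\<xi> = \<eta>"
proof (rule ccontr)
  assume "\<xi> \<noteq> \<eta>"
  define c where "c = 1 + d (midpoint \<xi> \<eta>) w"
  have "c \<ge> 1" by (simp add: c_def)
  have "\<exists>u\<in>D. d (y n) u \<le> c + 1 \<and> d (x n) u \<le> max 0 (d (x n) (y n) - (c + 1))" for n
    using geodesic_division[OF geodesic xy(1) xy(2), of "c + 1" n n] \<open>c \<ge> 1\<close> by force
  then obtain u where u: "\<And>n. u n \<in> D" "\<And>n. d (y n) (u n) \<le> c + 1"
    "\<And>n. d (x n) (u n) \<le> max 0 (d (x n) (y n) - (c + 1))"
    by metis
  have "u \<longlonglongrightarrow> \<eta>"
    by (rule boundary_limit_shared[OF xy(2) u(1) lim(2) \<open>\<eta> \<notin> D\<close> u(2)])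
  then have "eventually (\<lambda>n. d (x n) w \<le> d (x n) (u n) + c) sequentially"
    unfolding c_def by (intro separated_limits xy u(1) lim(1) \<open>\<xi> \<noteq> \<eta>\<close> \<open>w \<in> D\<close>)
  then have "eventually (\<lambda>n. d (x n) w \<le> c) sequentially"
  proof eventually_elim
    case (elim n)
    then show ?case using u(3)[of n] le[of n] by (simp add: max_def split: if_splits)
  qed
  then have "\<xi> \<in> D"
    using bounded_limit_in_domain[of x w] xy(1) \<open>w \<in> D\<close> lim(1) by blast
  then show False using \<open>\<xi> \<notin> D\<close> by blast
qed

section \<open>Convergence of iterates\<close>

text \<open>Write \<open>o n\<close> for the orbit and call \<open>n\<close> a peak if no earlier orbit point is farther from \<open>x\<close> than \<open>o n\<close>.
For a peak \<open>n\<close> and \<open>m \<le> n\<close> one has \<open>d (o n) (o m) \<le> d (o (n - m)) x \<le> d (o n) x\<close>, which is exactly the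
hypothesis of \<open>boundary_limits_eq\<close>. So a limit \<open>\<xi>\<close> of a sequence of peaks equals every other limit point of
the orbit; all limit points are on the boundary by Calka's theorem.\<close>

lemma unbounded_orbit_tendsto:
  assumes f: "nonexpansive_on D d f" "f \<in> D \<rightarrow> D" and "x \<in> D"
    and unbdd: "\<not> mbounded (range (\<lambda>n. (f ^^ n) x))"
  obtains \<xi> where "\<xi> \<in> closure D - D" "(\<lambda>n. (f ^^ n) x) \<longlonglongrightarrow> \<xi>"
proof -
  let ?o = "\<lambda>n. (f ^^ n) x"
  have o: "?o n \<in> D" for n by (rule funpow_mem[OF f(2) \<open>x \<in> D\<close>])
  then have o': "?o n \<in> closure D" for n by (rule subsetD[OF closure_subset])
  have escape: "\<eta> \<notin> D" if "strict_mono k" "(\<lambda>n. ?o (k n)) \<longlonglongrightarrow> \<eta>" for k \<eta>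
    using accumulating_orbit_mbounded[OF compactin_mcball f \<open>x \<in> D\<close> that(1)] limitin_mtopology_iff[of "\<lambda>n. ?o (k n)" \<eta>] o
      that(2) unbdd by blast
  have "\<exists>\<^sub>F n in sequentially. \<forall>m\<le>n. d (?o m) x \<le> d (?o n) x"
    unfolding frequently_sequentially
  proof (intro allI)
    fix N
    \<comment> \<open>The first orbit point farther from \<open>x\<close> than all those up to time \<open>N\<close> is a peak.\<close>
    have "\<exists>n. Max ((\<lambda>n. d (?o n) x) ` {..N}) < d (?o n) x" (is "\<exists>n. ?M < _")
    proof (rule ccontr)
      assume "\<not> ?thesis"
      then have "\<not> ?M < d (?o n) x" for n by blast
      then have "d x (?o n) \<le> ?M" for n unfolding not_less commute[of x] .
      then have "range ?o \<subseteq> mcball x ?M"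
        using o \<open>x \<in> D\<close> by auto
      then show False using unbdd unfolding mbounded_def by blast
    qed
    then obtain n where n: "?M < d (?o n) x" and least: "\<forall>m<n. \<not> ?M < d (?o m) x"
      unfolding exists_least_iff[of "\<lambda>n. ?M < d (?o n) x"] by blast
    have "N \<le> n"
    proof (rule ccontr)
      assume "\<not> N \<le> n"
      then have "d (?o n) x \<le> ?M" by (intro Max_ge) auto
      then show False using n by simp
    qed
    moreover have "d (?o m) x \<le> d (?o n) x" if "m \<le> n" for m
    proof (cases "m = n")
      case False
      then have "\<not> ?M < d (?o m) x" using least that by simp
      then show ?thesis using n by linarith
    qed simp
    ultimately show "\<exists>n\<ge>N. \<forall>m\<le>n. d (?o m) x \<le> d (?o n) x" by blast
  qed
  then obtain q :: "nat \<Rightarrow> nat" where q: "strict_mono q" and peak: "\<And>n m. m \<le> q n \<Longrightarrow> d (?o m) x \<le> d (?o (q n)) x"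
    using subseq_of_frequently[of "\<lambda>n. \<forall>m\<le>n. d (?o m) x \<le> d (?o n) x"] by metis
  obtain \<xi> p where "\<xi> \<in> closure D" and p: "strict_mono p" "((\<lambda>n. ?o (q n)) \<circ> p) \<longlonglongrightarrow> \<xi>"
    using compact_closure_D o' unfolding compact_def by metis
  define k where "k = q \<circ> p"
  have k: "strict_mono k" and lim: "(\<lambda>n. ?o (k n)) \<longlonglongrightarrow> \<xi>"
    using strict_mono_o[OF q p(1)] p(2) by (simp_all add: k_def comp_def)
  have "\<xi> \<notin> D" by (rule escape[OF k lim])
  have "?o \<longlonglongrightarrow> \<xi>"
  proof (rule ccontr)
    assume not: "\<not> ?o \<longlonglongrightarrow> \<xi>"
    obtain l \<eta> where l: "strict_mono l" and "\<eta> \<noteq> \<xi>" and lim': "(\<lambda>n. ?o (l n)) \<longlonglongrightarrow> \<eta>"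
      by (rule compact_not_tendsto_subseq[OF compact_closure_D o' not])
    \<comment> \<open>The time \<open>k (l n)\<close> is a peak not before \<open>l n\<close>, as \<open>k\<close> is strictly increasing.\<close>
    have "d (?o (k (l n))) (?o (l n)) \<le> d (?o (k (l n))) x" for n
    proof -
      have "d (?o (k (l n))) (?o (l n)) \<le> d (?o (k (l n) - l n)) x"
        by (rule nonexpansive_orbit_shift[OF f \<open>x \<in> D\<close> seq_suble[OF k]])
      also have "\<dots> \<le> d (?o (k (l n))) x"
        unfolding k_def comp_apply by (rule peak) simp
      finally show ?thesis .
    qed
    moreover have "(\<lambda>n. ?o (k (l n))) \<longlonglongrightarrow> \<xi>"
      using LIMSEQ_subseq_LIMSEQ[OF lim l] by (simp add: comp_def)
    ultimately have "\<xi> = \<eta>"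
      using o lim' \<open>\<xi> \<notin> D\<close> escape[OF l lim'] \<open>x \<in> D\<close>
      by (intro boundary_limits_eq[of "\<lambda>n. ?o (k (l n))" "\<lambda>n. ?o (l n)"]) auto
    then show False using \<open>\<eta> \<noteq> \<xi>\<close> by blast
  qed
  then show ?thesis using that \<open>\<xi> \<in> closure D\<close> \<open>\<xi> \<notin> D\<close> by blast
qed

text \<open>The iterates of points of \<open>K\<close> stay within a fixed \<open>d\<close>-distance of the orbit of \<open>x\<close>, so by
\<open>boundary_limit_shared\<close> they are drawn to the same boundary point, whatever points of \<open>K\<close> are chosen
for the different times.\<close>

lemma orbit_limit_uniform:
  assumes f: "nonexpansive_on D d f" "f \<in> D \<rightarrow> D" and "x \<in> D"
    and lim: "(\<lambda>n. (f ^^ n) x) \<longlonglongrightarrow> \<xi>" and "\<xi> \<notin> D" and K: "mbounded K"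
  shows "uniform_limit K (\<lambda>n. f ^^ n) (\<lambda>_. \<xi>) sequentially"
proof (rule ccontr)
  assume "\<not> ?thesis"
  then obtain e where "e > 0" and "\<not> (\<forall>\<^sub>F n in sequentially. \<forall>y\<in>K. dist ((f ^^ n) y) \<xi> < e)"
    unfolding uniform_limit_iff by blast
  then have "\<exists>\<^sub>F n in sequentially. \<exists>y\<in>K. e \<le> dist ((f ^^ n) y) \<xi>"
    by (simp add: not_eventually not_less)
  then obtain r :: "nat \<Rightarrow> nat" where r: "strict_mono r" "\<And>n. \<exists>y\<in>K. e \<le> dist ((f ^^ r n) y) \<xi>"
    using subseq_of_frequently by blast
  then obtain y where y: "\<And>n. y n \<in> K" "\<And>n. e \<le> dist ((f ^^ r n) (y n)) \<xi>" by metis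
  have yD: "y n \<in> D" for n using y(1) K mbounded_subset_mspace by blast
  obtain c where c: "\<And>y. y \<in> K \<Longrightarrow> d x y \<le> c"
  proof -
    have "mbounded (insert x K)" using K \<open>x \<in> D\<close> by (simp add: mbounded_insert)
    then show ?thesis using that unfolding mbounded_alt by blast
  qed
  have "(\<lambda>n. (f ^^ r n) (y n)) \<longlonglongrightarrow> \<xi>"
  proof (rule boundary_limit_shared[OF _ _ _ \<open>\<xi> \<notin> D\<close>])
    show "(\<lambda>n. (f ^^ r n) x) \<longlonglongrightarrow> \<xi>"
      using LIMSEQ_subseq_LIMSEQ[OF lim r(1)] by (simp add: comp_def)
    show "d ((f ^^ r n) x) ((f ^^ r n) (y n)) \<le> c" for n
      using nonexpansive_funpow[OF f \<open>x \<in> D\<close> yD] c[OF y(1)] order_trans by blast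
  qed (use funpow_mem[OF f(2)] \<open>x \<in> D\<close> yD in blast)+
  then have "\<exists>n. dist ((f ^^ r n) (y n)) \<xi> < e"
    using \<open>e > 0\<close> by (auto simp: tendsto_iff eventually_sequentially)
  then show False using y(2) not_less by blast
qed

end

theorem theorem4p5:
  fixes D :: "'a::real_normed_vector set"
    and d :: "'a \<Rightarrow> 'a \<Rightarrow> real"
    and f :: "'a \<Rightarrow> 'a"
  assumes finite_dim: "\<exists>B::'a set. finite B \<and> span B = UNIV"
    and domain: "open D" "connected D" "D \<noteq> {}"
    and bounded: "bounded D"
    and strictly_convex: "strictly_convex D"
    and metric: "Metric_space D d"
    and complete: "Metric_space.mcomplete D d"
    and geodesic: "geodesic_space D d"
    and topology: "Metric_space.mtopology D d = top_of_set D"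
    and quasiconvex: "\<And>x y z s. \<lbrakk>x \<in> D; y \<in> D; z \<in> D; 0 \<le> s; s \<le> 1\<rbrakk> \<Longrightarrow>
          d (s *\<^sub>R x + (1 - s) *\<^sub>R y) z \<le> max (d x z) (d y z)"
    and self_map: "f \<in> D \<rightarrow> D"
    and nonexpansive: "nonexpansive_on D d f"
    and no_fixed_point: "\<forall>x\<in>D. f x \<noteq> x"
  shows "\<exists>\<xi>\<in>closure D - D. \<forall>K. Metric_space.mbounded D d K \<longrightarrow>
           uniform_limit K (\<lambda>n. f ^^ n) (\<lambda>_. \<xi>) sequentially"
proof -
  interpret Metric_space D d by (rule metric)
  interpret quasiconvex_domain D d
    by (rule quasiconvex_domain.intro[OF metric quasiconvex_domain_axioms.intro
          [OF finite_dim domain(1) bounded strictly_convex complete geodesic topology quasiconvex]])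
  obtain x where "x \<in> D" using \<open>D \<noteq> {}\<close> by blast
  have "\<not> mbounded (range (\<lambda>n. (f ^^ n) x))"
    using bounded_orbit_imp_fixed_point[OF nonexpansive self_map \<open>x \<in> D\<close>] no_fixed_point by blast
  then obtain \<xi> where \<xi>: "\<xi> \<in> closure D - D" "(\<lambda>n. (f ^^ n) x) \<longlonglongrightarrow> \<xi>"
    using unbounded_orbit_tendsto[OF nonexpansive self_map \<open>x \<in> D\<close>] by blast
  then show ?thesis
    using orbit_limit_uniform[OF nonexpansive self_map \<open>x \<in> D\<close>] by blast
qed

end
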